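(* Let $\kappa$ be an infinite cardinal such that $2^{\kappa}=\kappa^+$. Then there is a $\kappa^+$-barely independent family over $\kappa^+$.
   Context: Notation: for a set $X$ and $A\subseteq X$, put $A^0=A$ and $A^1=X\setminus A$. For a family $\mathcal{A}$ of subsets of $X$ and $h:\mathcal{A}\to 2=\{0,1\}$, put $\mathcal{A}^h=\{A^{h(A)} : A\in\mathcal{A}\}$. The intersection of the empty family of subsets of $X$ is $X$. For a cardinal $\nu$, $[X]^{\nu}$ (resp. $[X]^{<\nu}$) is the set of subsets of $X$ of cardinality $\nu$ (resp. less than $\nu$). Definition: let $\nu\leq\lambda$ be infinite cardinals and let $\mathcal{I}\subseteq[\lambda]^{\lambda}$. The family $\mathcal{I}$ is called $\nu$-barely independent (over $\lambda$) if $|\mathcal{I}|\geq\nu$ and (i) $|\bigcap\mathcal{A}^h|=\lambda$ for every $\mathcal{A}\in[\mathcal{I}]^{<\nu}$ and every $h:\mathcal{A}\to 2$; (ii) $|\bigcap\mathcal{A}^h|<\lambda$ for every $\mathcal{A}\in[\mathcal{I}]^{\nu}$ and every $h:\mathcal{A}\to 2$. *)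

theory Defs
  imports Main
begin

unbundle cardinal_syntax

text \<open>
  Cardinals are represented, as in the library, by cardinal well-orders
  (\<open>Card_order\<close>), compared with \<open>\<le>o\<close>, \<open><o\<close> and \<open>=o\<close>.  The underlying set of a
  cardinal \<open>\<mu>\<close> is \<open>Field \<mu>\<close>.
\<close>

definition subsets_of_card :: "'a set \<Rightarrow> 'b rel \<Rightarrow> 'a set set" where
  "subsets_of_card X \<nu> = {A. A \<subseteq> X \<and> |A| =o \<nu>}"

definition subsets_of_less_card :: "'a set \<Rightarrow> 'b rel \<Rightarrow> 'a set set" where
  "subsets_of_less_card X \<nu> = {A. A \<subseteq> X \<and> |A| <o \<nu>}"

text \<open>
  The two exponents are the truth values: \<open>False\<close> is 0 and \<open>True\<close> is 1.
\<close>

definition set_sgn :: "'a set \<Rightarrow> 'a set \<Rightarrow> bool \<Rightarrow> 'a set" where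
  "set_sgn X A e = (if e then X - A else A)"

text \<open>
  A function \<open>h\<close> from the family \<open>\<A>\<close> to 2 is rendered as a total function on sets;
  only its values on members of \<open>\<A>\<close> are used.
\<close>

definition family_sgn :: "'a set \<Rightarrow> 'a set set \<Rightarrow> ('a set \<Rightarrow> bool) \<Rightarrow> 'a set set" where
  "family_sgn X \<A> h = (\<lambda>A. set_sgn X A (h A)) ` \<A>"

text \<open>
  Intersecting with \<open>X\<close> matters only for the empty family, whose intersection is to
  be \<open>X\<close> rather than \<open>UNIV\<close>.
\<close>

definition Inter_within :: "'a set \<Rightarrow> 'a set set \<Rightarrow> 'a set" where
  "Inter_within X \<F> = X \<inter> \<Inter>\<F>"

definition barely_independent :: "'b rel \<Rightarrow> 'a rel \<Rightarrow> 'a set set \<Rightarrow> bool" where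
  "barely_independent \<nu> \<mu> \<I> \<longleftrightarrow>
     Card_order \<nu> \<and> cinfinite \<nu> \<and> Card_order \<mu> \<and> cinfinite \<mu> \<and> \<nu> \<le>o \<mu> \<and>
     \<I> \<subseteq> subsets_of_card (Field \<mu>) \<mu> \<and>
     \<nu> \<le>o |\<I>| \<and>
     (\<forall>\<A> \<in> subsets_of_less_card \<I> \<nu>. \<forall>h.
        |Inter_within (Field \<mu>) (family_sgn (Field \<mu>) \<A> h)| =o \<mu>) \<and>
     (\<forall>\<A> \<in> subsets_of_card \<I> \<nu>. \<forall>h.
        |Inter_within (Field \<mu>) (family_sgn (Field \<mu>) \<A> h)| <o \<mu>)"

end

theory Submission
  imports Defs
begin

text \<open>
  Let \<open>\<mu> = \<kappa>\<^sup>+\<close>. As \<open>2\<^sup>\<kappa> = \<mu>\<close>, the subsets of \<open>\<mu>\<close> of size at most \<open>\<kappa>\<close> can be listed as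
  \<open>(S \<alpha>)\<close>, \<open>\<alpha> < \<mu>\<close>, with every set occurring \<open>\<mu>\<close> times. For each \<open>\<xi>\<close> some \<open>W \<xi>\<close> splits all
  those of the at most \<open>\<kappa>\<close> many sets \<open>S \<beta>\<close>, \<open>\<beta> < \<xi>\<close>, that have size \<open>\<kappa>\<close>. Let \<open>A \<xi>\<close> agree
  with \<open>W \<xi>\<close> below \<open>\<xi>\<close>, and let it contain \<open>\<alpha> \<ge> \<xi>\<close> iff \<open>\<xi> \<in> S \<alpha>\<close>. A sign pattern on at most
  \<open>\<kappa>\<close> indices is realised by every \<open>\<alpha>\<close> that lies above those indices and has the right
  \<open>S \<alpha>\<close>, so the combination has size \<open>\<mu>\<close>. If a combination of \<open>\<mu>\<close> many sets had \<open>\<kappa>\<close>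
  elements, these would form some \<open>S \<beta>\<close>, and the set \<open>A \<xi>\<close> of any sufficiently large index
  \<open>\<xi>\<close> of the combination would split it, which is absurd.
\<close>

section \<open>Choosing distinct points and splitting many sets at once\<close>

lemma finite_ordLeq_Cinfinite:
  assumes "finite X" and "Cinfinite r"
  shows "|X| \<le>o r"
  using assms unfolding cinfinite_def
  by (intro ordLess_imp_ordLeq finite_ordLess_infinite card_of_Well_order
      card_order_on_well_order_on) (simp_all add: Field_card_of)

lemma Cinfinite_ordLeq_nonempty:
  assumes "Cinfinite r" and "r \<le>o |X|"
  shows "X \<noteq> {}"
proof
  assume "X = {}"
  have "|Field r| \<le>o |X|"
    using assms card_of_Field_ordIso ordIso_ordLeq_trans by blast
  then have "Field r = {}"
    unfolding \<open>X = {}\<close> by (rule card_of_empty3)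
  then show False
    using assms(1) by (simp add: cinfinite_def)
qed

text \<open>Recursion along the cardinal well-order of \<open>I\<close>: the values used before
  stage \<open>i\<close> are fewer than \<open>|I|\<close>, hence do not exhaust
  \<open>T i\<close>.\<close>

lemma injective_choice:
  assumes large: "\<And>i. i \<in> I \<Longrightarrow> |I| \<le>o |T i|"
  shows "\<exists>f. inj_on f I \<and> (\<forall>i\<in>I. f i \<in> T i)"
proof -
  define r where "r = |I|"
  have co: "Card_order r" and field: "Field r = I"
    by (simp_all add: r_def card_of_card_order_on Field_card_of)
  have wo: "Well_order r"
    using co by (rule card_order_on_well_order_on)
  then have wf: "wf (r - Id)"
    by (simp add: well_order_on_def)
  have tot: "total_on I r"
    using wo field by (simp add: well_order_on_def linear_order_on_def)
  define f where "f = wfrec (r - Id) (\<lambda>f i. SOME x. x \<in> T i - f ` underS r i)"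
  have f_eq: "f i = (SOME x. x \<in> T i - f ` underS r i)" for i
  proof -
    \<comment> \<open>\<open>wfrec\<close> passes on only the values at predecessors of
      \<open>i\<close>, and the body asks for no others.\<close>
    have "f i = (SOME x. x \<in> T i - cut f (r - Id) i ` underS r i)"
      using wfrec[OF wf] by (simp add: f_def)
    moreover have "cut f (r - Id) i ` underS r i = f ` underS r i"
      by (intro image_cong) (auto simp: cut_def underS_def)
    ultimately show ?thesis by simp
  qed
  have f_in: "f i \<in> T i - f ` underS r i" if "i \<in> I" for i
  proof -
    have "|f ` underS r i| <o |T i|"
      using card_of_image card_of_underS[OF co] large[OF that] that field
      by (metis ordLeq_ordLess_trans ordLess_ordLeq_trans r_def)
    then have "\<not> T i \<subseteq> f ` underS r i"
      using card_of_mono1 not_ordLess_ordLeq by blast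
    then show ?thesis
      unfolding f_eq[of i] by (metis (no_types, lifting) Diff_iff someI subsetI)
  qed
  have "f i \<noteq> f j" if "i \<in> I" "j \<in> I" "i \<noteq> j" for i j
  proof -
    have "i \<in> underS r j \<or> j \<in> underS r i"
      using tot that by (auto simp: total_on_def underS_def)
    then show ?thesis
      using f_in[OF \<open>i \<in> I\<close>] f_in[OF \<open>j \<in> I\<close>] by (metis DiffD2 imageI)
  qed
  then show ?thesis
    using f_in by (auto simp: inj_on_def intro!: exI[of _ f])
qed

text \<open>Every \<open>T i\<close> receives two points of its own, labelled by truth values;
  \<open>W\<close> collects those labelled \<open>True\<close>, and injectivity keeps the others
  out.\<close>

lemma splitting_set:
  assumes inf: "Cinfinite \<kappa>" and I: "|I| \<le>o \<kappa>"
    and large: "\<And>i. i \<in> I \<Longrightarrow> \<kappa> \<le>o |T i|"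
  shows "\<exists>W. \<forall>i\<in>I. T i \<inter> W \<noteq> {} \<and> T i - W \<noteq> {}"
proof -
  let ?J = "I \<times> (UNIV :: bool set)"
  have "|UNIV :: bool set| \<le>o \<kappa>"
    using ctwo_ordLeq_Cinfinite[OF inf] by (simp add: ctwo_def)
  then have "|?J| \<le>o \<kappa>"
    using I inf by (intro card_of_Times_ordLeq_infinite_Field) (auto simp: cinfinite_def)
  then have "|?J| \<le>o |case j of (i, b) \<Rightarrow> T i|" if "j \<in> ?J" for j
    using that large by (auto intro: ordLeq_transitive)
  from injective_choice[OF this] obtain f
    where inj: "inj_on f ?J" and f: "\<And>i b. i \<in> I \<Longrightarrow> f (i, b) \<in> T i"
    by fastforce
  have "f (i, False) \<notin> (\<lambda>i. f (i, True)) ` I" if "i \<in> I" for i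
    using inj that by (auto simp: inj_on_def)
  then show ?thesis
    using f by (intro exI[of _ "(\<lambda>i. f (i, True)) ` I"]) blast
qed

section \<open>Listing the small subsets\<close>

lemma card_subsets_of_bounded_card:
  assumes inf: "Cinfinite \<kappa>" and L: "Cinfinite \<mu>" and pow: "ctwo ^c \<kappa> =o \<mu>"
  shows "|{X. X \<subseteq> Field \<mu> \<and> |X| \<le>o \<kappa>}| \<le>o \<mu>"
proof -
  \<comment> \<open>Nonempty sets of size at most \<open>\<kappa>\<close> are images of
    \<open>Field \<kappa>\<close>, and \<open>\<mu> ^c \<kappa>\<close> equals
    \<open>(ctwo ^c \<kappa>) ^c \<kappa>\<close>, that is, \<open>\<mu>\<close>. The empty set is
    no such image and is added separately.\<close>
  let ?N = "(\<lambda>f. f ` Field \<kappa>) ` Func (Field \<kappa>) (Field \<mu>)"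
  have "\<mu> ^c \<kappa> =o (ctwo ^c \<kappa>) ^c \<kappa>"
    using inf by (intro cexp_cong1 ordIso_symmetric[OF pow]) simp
  also have "(ctwo ^c \<kappa>) ^c \<kappa> =o ctwo ^c \<kappa>"
    using inf by (intro cexp_cprod_ordLeq Cinfinite_Cnotzero Card_order_ctwo ordLeq_refl) simp_all
  also note pow
  finally have "|Func (Field \<kappa>) (Field \<mu>)| \<le>o \<mu>"
    by (simp add: cexp_def ordIso_imp_ordLeq)
  then have N: "|?N| \<le>o \<mu>"
    using card_of_image ordLeq_transitive by blast
  have emp: "|{{} :: 'b set}| \<le>o \<mu>"
    using L by (simp add: finite_ordLeq_Cinfinite)
  have sub: "{X. X \<subseteq> Field \<mu> \<and> |X| \<le>o \<kappa>} \<subseteq> ?N \<union> {{}}"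
  proof
    fix X assume "X \<in> {X. X \<subseteq> Field \<mu> \<and> |X| \<le>o \<kappa>}"
    then have X: "X \<subseteq> Field \<mu>" "|X| \<le>o \<kappa>" by auto
    show "X \<in> ?N \<union> {{}}"
    proof (cases "X = {}")
      case False
      have "|X| \<le>o |Field \<kappa>|"
        using X inf by (meson Card_order_iff_ordLeq_card_of ordLeq_transitive)
      then obtain g where g: "g ` Field \<kappa> = X"
        unfolding card_of_ordLeq2[OF False, symmetric] by (elim exE)
      let ?g = "\<lambda>x. if x \<in> Field \<kappa> then g x else undefined"
      have "?g \<in> Func (Field \<kappa>) (Field \<mu>)" "?g ` Field \<kappa> = X"
        using g X by (auto simp: Func_def)
      then show ?thesis by blast
    qed simp
  qed
  have "|?N \<union> {{}}| \<le>o \<mu>"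
    using N emp L by (rule Un_Cinfinite_bound)
  with card_of_mono1[OF sub] show ?thesis
    by (rule ordLeq_transitive)
qed

text \<open>Take the first coordinate of a surjection from \<open>Field \<mu>\<close> onto
  \<open>?B \<times> Field \<mu>\<close>; the second coordinate maps the fibre over \<open>X\<close>
  onto \<open>Field \<mu>\<close>. The repetitions let each set be found beyond any given
  bound.\<close>

lemma enumeration_of_bounded_subsets:
  assumes inf: "Cinfinite \<kappa>" and L: "Cinfinite \<mu>" and pow: "ctwo ^c \<kappa> =o \<mu>"
  shows "\<exists>S. \<forall>X. X \<subseteq> Field \<mu> \<longrightarrow> |X| \<le>o \<kappa> \<longrightarrow> \<mu> \<le>o |{\<alpha> \<in> Field \<mu>. S \<alpha> = X}|"
proof -
  let ?B = "{X. X \<subseteq> Field \<mu> \<and> |X| \<le>o \<kappa>}"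
  have field: "\<mu> \<le>o |Field \<mu>|" "|Field \<mu>| \<le>o \<mu>"
    using L by (simp_all add: card_of_Field_ordIso ordIso_imp_ordLeq ordIso_symmetric)
  have "|?B \<times> Field \<mu>| \<le>o \<mu>"
    using L card_subsets_of_bounded_card[OF assms] field
    by (intro card_of_Times_ordLeq_infinite_Field) (auto simp: cinfinite_def)
  then have "|?B \<times> Field \<mu>| \<le>o |Field \<mu>|"
    using field by (blast intro: ordLeq_transitive)
  moreover have "{} \<in> ?B"
    using inf by (simp add: Card_order_empty)
  moreover have "Field \<mu> \<noteq> {}" using L by (auto simp: cinfinite_def)
  ultimately obtain e where e: "e ` Field \<mu> = ?B \<times> Field \<mu>"
    using card_of_ordLeq2[of "?B \<times> Field \<mu>" "Field \<mu>"] by blast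
  have "\<mu> \<le>o |{\<alpha> \<in> Field \<mu>. fst (e \<alpha>) = X}|" if X: "X \<in> ?B" for X
  proof -
    have "Field \<mu> \<subseteq> (\<lambda>\<alpha>. snd (e \<alpha>)) ` {\<alpha> \<in> Field \<mu>. fst (e \<alpha>) = X}"
    proof
      fix \<gamma> assume "\<gamma> \<in> Field \<mu>"
      then have "(X, \<gamma>) \<in> e ` Field \<mu>"
        unfolding e using X by (rule SigmaI[rotated])
      then obtain \<alpha> where "\<alpha> \<in> Field \<mu>" "e \<alpha> = (X, \<gamma>)" by (metis imageE)
      then show "\<gamma> \<in> (\<lambda>\<alpha>. snd (e \<alpha>)) ` {\<alpha> \<in> Field \<mu>. fst (e \<alpha>) = X}"
        by (intro image_eqI[of _ _ \<alpha>]) simp_all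
    qed
    then show ?thesis
      using field by (meson card_of_mono1 card_of_image ordLeq_transitive)
  qed
  then show ?thesis
    by (intro exI[of _ "\<lambda>\<alpha>. fst (e \<alpha>)"]) blast
qed

section \<open>Bounds and differences\<close>

lemma cardSuc_upper_bound:
  assumes inf: "Cinfinite \<kappa>" and X: "X \<subseteq> Field (cardSuc \<kappa>)" "|X| \<le>o \<kappa>"
  shows "\<exists>\<gamma>\<in>Field (cardSuc \<kappa>). \<forall>x\<in>X. (x, \<gamma>) \<in> cardSuc \<kappa>"
proof -
  have wo: "Well_order (cardSuc \<kappa>)"
    using inf by (simp add: cardSuc_Card_order card_order_on_well_order_on)
  then have tot: "total_on (Field (cardSuc \<kappa>)) (cardSuc \<kappa>)"
    and ref: "refl_on (Field (cardSuc \<kappa>)) (cardSuc \<kappa>)"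
    by (simp_all add: order_on_defs)
  have "\<not> |X| =o cardSuc \<kappa>"
    using X inf by (meson cardSuc_greater not_ordLess_ordIso ordLeq_ordLess_trans)
  then have "\<not> cofinal X (cardSuc \<kappa>)"
    using regularCard_cardSuc[OF inf] X by (auto simp: regularCard_def)
  \<comment> \<open>By regularity \<open>X\<close> is not cofinal. As \<open>cofinal\<close> asks
    for strictly larger elements, some \<open>\<gamma>\<close> has none of \<open>X\<close> above
    it, and totality makes it a bound.\<close>
  then obtain \<gamma> where \<gamma>: "\<gamma> \<in> Field (cardSuc \<kappa>)"
    "\<And>x. x \<in> X \<Longrightarrow> \<gamma> = x \<or> (\<gamma>, x) \<notin> cardSuc \<kappa>"
    by (auto simp: cofinal_def)
  have "(x, \<gamma>) \<in> cardSuc \<kappa>" if "x \<in> X" for x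
    using \<gamma> that X tot ref by (metis refl_onD subsetD total_on_def)
  with \<gamma>(1) show ?thesis by blast
qed

lemma card_of_Diff_ordLeq:
  assumes inf: "Cinfinite \<mu>" and A: "\<mu> \<le>o |A|" and B: "|B| <o \<mu>"
  shows "\<mu> \<le>o |A - B|"
proof (rule ccontr)
  assume "\<not> \<mu> \<le>o |A - B|"
  then have "|A - B| <o \<mu>"
    using inf by (meson card_of_Well_order card_order_on_well_order_on not_ordLeq_iff_ordLess)
  then have "|(A - B) \<union> B| <o \<mu>"
    using B inf by (rule Un_Cinfinite_bound_strict)
  moreover have "|A| \<le>o |(A - B) \<union> B|"
    by (rule card_of_mono1) auto
  ultimately show False
    using A by (meson not_ordLess_ordLeq ordLeq_transitive)
qed

theorem theorem3p7:
  fixes \<kappa> :: "'a rel"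
  assumes "Card_order \<kappa>" and "cinfinite \<kappa>"
    and "ctwo ^c \<kappa> =o cardSuc \<kappa>"
  shows "\<exists>\<I>. barely_independent (cardSuc \<kappa>) (cardSuc \<kappa>) \<I>"
proof -

  \<comment> \<open>Construction of the family\<close>
  define \<mu> where "\<mu> = cardSuc \<kappa>"
  define F where "F = Field \<mu>"
  have inf: "Cinfinite \<kappa>" using assms by simp
  have \<mu>: "Cinfinite \<mu>" using inf by (simp add: \<mu>_def Cinfinite_cardSuc)
  have less_iff: "|B| <o \<mu> \<longleftrightarrow> |B| \<le>o \<kappa>" for B :: "'x set"
    using assms(1) by (simp add: \<mu>_def cardSuc_ordLeq_ordLess card_of_Card_order)
  have F_iso: "|F| =o \<mu>"
    using \<mu> by (simp add: F_def card_of_Field_ordIso)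
  have wo: "Well_order \<mu>"
    using \<mu> by (simp add: card_order_on_well_order_on)
  then have tot: "total_on F \<mu>" and ref: "refl_on F \<mu>" and tr: "trans \<mu>" and as: "antisym \<mu>"
    by (simp_all add: order_on_defs F_def)
  have bound: "\<exists>\<gamma>\<in>F. \<forall>x\<in>X. (x, \<gamma>) \<in> \<mu>" if "X \<subseteq> F" "|X| \<le>o \<kappa>" for X
    using cardSuc_upper_bound[OF inf] that by (simp add: F_def \<mu>_def)
  have tail: "(\<gamma>, \<alpha>) \<in> \<mu>" if "\<alpha> \<in> F" "\<gamma> \<in> F" "\<alpha> \<notin> underS \<mu> \<gamma>" for \<alpha> \<gamma>
  proof (cases "\<gamma> = \<alpha>")
    case True
    then show ?thesis using refl_onD[OF ref that(1)] by simp
  next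
    case False
    have "(\<alpha>, \<gamma>) \<notin> \<mu>" using that(3) False by (simp add: underS_def)
    then show ?thesis using tot[unfolded total_on_def, rule_format, OF that(2,1) False] by simp
  qed
  have small: "|underS \<mu> \<gamma>| <o \<mu>" if "\<gamma> \<in> F" for \<gamma>
    using \<mu> that by (simp add: F_def card_of_underS)
  obtain S where "\<forall>X. X \<subseteq> F \<longrightarrow> |X| \<le>o \<kappa> \<longrightarrow> \<mu> \<le>o |{\<alpha> \<in> F. S \<alpha> = X}|"
    using enumeration_of_bounded_subsets[OF inf \<mu> assms(3)[folded \<mu>_def]]
    unfolding F_def by (rule exE)
  note S = this[rule_format]
  have "\<forall>\<xi>\<in>F. \<exists>W. \<forall>\<beta>\<in>{\<beta> \<in> underS \<mu> \<xi>. \<kappa> \<le>o |S \<beta>|}. S \<beta> \<inter> W \<noteq> {} \<and> S \<beta> - W \<noteq> {}"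
  proof (intro ballI splitting_set[OF inf])
    fix \<xi> assume "\<xi> \<in> F"
    have "|underS \<mu> \<xi>| \<le>o \<kappa>"
      using small[OF \<open>\<xi> \<in> F\<close>] less_iff by blast
    moreover have "|{\<beta> \<in> underS \<mu> \<xi>. \<kappa> \<le>o |S \<beta>|}| \<le>o |underS \<mu> \<xi>|"
      by (rule card_of_mono1) auto
    ultimately show "|{\<beta> \<in> underS \<mu> \<xi>. \<kappa> \<le>o |S \<beta>|}| \<le>o \<kappa>"
      using ordLeq_transitive by blast
  qed auto
  then obtain W where "\<forall>\<xi>\<in>F. \<forall>\<beta>\<in>{\<beta> \<in> underS \<mu> \<xi>. \<kappa> \<le>o |S \<beta>|}.
      S \<beta> \<inter> W \<xi> \<noteq> {} \<and> S \<beta> - W \<xi> \<noteq> {}"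
    by (rule bchoice[THEN exE])
  then have W: "S \<beta> \<inter> W \<xi> \<noteq> {} \<and> S \<beta> - W \<xi> \<noteq> {}"
    if "\<xi> \<in> F" "\<beta> \<in> underS \<mu> \<xi>" "\<kappa> \<le>o |S \<beta>|" for \<xi> \<beta>
    using that by blast
  \<comment> \<open>The part below \<open>\<xi>\<close> serves condition (ii), the rest condition
    (i).\<close>
  define A where "A \<xi> = {\<alpha> \<in> F. if \<alpha> \<in> underS \<mu> \<xi> then \<alpha> \<in> W \<xi> else \<xi> \<in> S \<alpha>}" for \<xi>

  \<comment> \<open>Combinations of few sets\<close>
  have indep: "\<mu> \<le>o |{\<alpha> \<in> F. \<forall>\<xi>\<in>X. \<alpha> \<in> A \<xi> \<longleftrightarrow> \<xi> \<in> P}|"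
    if X: "X \<subseteq> F" "|X| \<le>o \<kappa>" and P: "P \<subseteq> X" for X P
  proof -
    obtain \<gamma> where \<gamma>: "\<gamma> \<in> F" "\<And>\<xi>. \<xi> \<in> X \<Longrightarrow> (\<xi>, \<gamma>) \<in> \<mu>"
      using bound[OF X] by blast
    have "P \<subseteq> F" "|P| \<le>o \<kappa>"
      using X P ordLeq_transitive[OF card_of_mono1[OF P]] by blast+
    \<comment> \<open>\<open>P\<close> holds the indices of the uncomplemented sets. It is listed
      \<open>\<mu>\<close> times, and fewer than \<open>\<mu>\<close> positions lie below
      \<open>\<gamma>\<close>; at the others every index in \<open>X\<close> falls under the second
      branch of \<open>A\<close>.\<close>
    then have "\<mu> \<le>o |{\<alpha> \<in> F. S \<alpha> = P} - underS \<mu> \<gamma>|"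
      using S small[OF \<gamma>(1)] by (intro card_of_Diff_ordLeq[OF \<mu>])
    moreover have "{\<alpha> \<in> F. S \<alpha> = P} - underS \<mu> \<gamma> \<subseteq> {\<alpha> \<in> F. \<forall>\<xi>\<in>X. \<alpha> \<in> A \<xi> \<longleftrightarrow> \<xi> \<in> P}"
    proof clarsimp
      fix \<alpha> \<xi> assume \<alpha>: "\<alpha> \<in> F" "\<alpha> \<notin> underS \<mu> \<gamma>" and "P = S \<alpha>" and \<xi>: "\<xi> \<in> X"
      have "(\<xi>, \<alpha>) \<in> \<mu>"
        using tail[OF \<alpha>(1) \<gamma>(1) \<alpha>(2)] \<gamma>(2)[OF \<xi>] tr by (meson transD)
      then have "\<alpha> \<notin> underS \<mu> \<xi>"
        using as by (auto simp: underS_def antisym_def)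
      then show "(\<alpha> \<in> A \<xi>) = (\<xi> \<in> S \<alpha>)"
        using \<alpha> by (simp add: A_def)
    qed
    ultimately show ?thesis
      using card_of_mono1 ordLeq_transitive by blast
  qed
  note fin = finite_ordLeq_Cinfinite[OF _ inf]
  have sub_iso: "|B| =o \<mu>" if "B \<subseteq> F" "\<mu> \<le>o |B|" for B
    using that F_iso by (meson card_of_mono1 ordIso_iff_ordLeq ordLeq_transitive)
  have inj: "inj_on A F"
  proof (rule inj_onI, rule ccontr)
    fix \<xi> \<eta> assume *: "\<xi> \<in> F" "\<eta> \<in> F" "A \<xi> = A \<eta>" "\<xi> \<noteq> \<eta>"
    \<comment> \<open>This pattern asks for points of \<open>A \<xi>\<close> outside
      \<open>A \<eta>\<close>.\<close>
    then have "\<mu> \<le>o |{\<alpha> \<in> F. \<forall>\<zeta>\<in>{\<xi>, \<eta>}. \<alpha> \<in> A \<zeta> \<longleftrightarrow> \<zeta> \<in> {\<xi>}}|"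
      by (intro indep fin) auto
    from Cinfinite_ordLeq_nonempty[OF \<mu> this] show False
      using * by auto
  qed
  have A_card: "A \<xi> \<in> subsets_of_card F \<mu>" if "\<xi> \<in> F" for \<xi>
  proof -
    have "\<mu> \<le>o |{\<alpha> \<in> F. \<forall>\<zeta>\<in>{\<xi>}. \<alpha> \<in> A \<zeta> \<longleftrightarrow> \<zeta> \<in> {\<xi>}}|"
      using that by (intro indep fin) auto
    moreover have "{\<alpha> \<in> F. \<forall>\<zeta>\<in>{\<xi>}. \<alpha> \<in> A \<zeta> \<longleftrightarrow> \<zeta> \<in> {\<xi>}} = A \<xi>"
      by (auto simp: A_def)
    ultimately show ?thesis
      using sub_iso[of "A \<xi>"] by (auto simp: subsets_of_card_def A_def)
  qed
  have size: "\<mu> \<le>o |A ` F|"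
    using inj F_iso by (meson card_of_ordIsoI inj_on_imp_bij_betw ordIso_iff_ordLeq
        ordLeq_ordIso_trans)
  have Inter_eq: "Inter_within F (family_sgn F (A ` X) h) = {\<alpha> \<in> F. \<forall>\<xi>\<in>X. \<alpha> \<in> A \<xi> \<longleftrightarrow> \<not> h (A \<xi>)}"
    for X h
    by (auto simp: Inter_within_def family_sgn_def set_sgn_def split: if_splits)
  have low: "|Inter_within F (family_sgn F \<A> h)| =o \<mu>"
    if \<A>: "\<A> \<in> subsets_of_less_card (A ` F) \<mu>" for \<A> h
  proof -
    have sub: "\<A> \<subseteq> A ` F" and "|\<A>| <o \<mu>"
      using \<A> by (auto simp: subsets_of_less_card_def)
    \<comment> \<open>One index for each member, so that \<open>X\<close> is no larger than
      \<open>\<A>\<close>.\<close>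
    obtain X where X: "X \<subseteq> F" "inj_on A X" "\<A> = A ` X"
      using sub by (metis subset_image_inj)
    have "|X| \<le>o |\<A>|"
      using X by (meson card_of_ordIsoI inj_on_imp_bij_betw ordIso_iff_ordLeq)
    then have "|X| \<le>o \<kappa>"
      using \<open>|\<A>| <o \<mu>\<close> less_iff ordLeq_transitive by blast
    with X(1) have "\<mu> \<le>o |{\<alpha> \<in> F. \<forall>\<xi>\<in>X. \<alpha> \<in> A \<xi> \<longleftrightarrow> \<xi> \<in> {\<xi> \<in> X. \<not> h (A \<xi>)}}|"
      by (rule indep) auto
    moreover have "{\<alpha> \<in> F. \<forall>\<xi>\<in>X. \<alpha> \<in> A \<xi> \<longleftrightarrow> \<xi> \<in> {\<xi> \<in> X. \<not> h (A \<xi>)}}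
        = Inter_within F (family_sgn F \<A> h)"
      unfolding X(3) Inter_eq by auto
    ultimately show ?thesis
      by (intro sub_iso) (auto simp: Inter_within_def)
  qed

  \<comment> \<open>Combinations of \<open>\<mu>\<close> many sets\<close>
  have high: "|Inter_within F (family_sgn F \<A> h)| <o \<mu>"
    if \<A>: "\<A> \<in> subsets_of_card (A ` F) \<mu>" for \<A> h
  proof (rule ccontr)
    let ?Z = "Inter_within F (family_sgn F \<A> h)"
    have sub: "\<A> \<subseteq> A ` F" and "|\<A>| =o \<mu>"
      using \<A> by (auto simp: subsets_of_card_def)
    obtain X where X: "X \<subseteq> F" "\<A> = A ` X"
      using sub by (metis subset_image_iff)
    have "\<mu> \<le>o |X|"
      using \<open>|\<A>| =o \<mu>\<close> X(2) card_of_image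
      by (metis ordIso_ordLeq_trans ordIso_symmetric)
    assume "\<not> |?Z| <o \<mu>"
    then have "\<kappa> \<le>o |?Z|"
      using less_iff ordLeq_total[OF card_order_on_well_order_on card_of_Well_order] assms(1)
      by blast
    then have "|Field \<kappa>| \<le>o |?Z|"
      using assms(1) by (meson card_of_Field_ordIso ordIso_ordLeq_trans)
    \<comment> \<open>Size exactly \<open>\<kappa>\<close>: small enough for \<open>Y\<close> to be
      listed by \<open>S\<close>, large enough to be split by the sets
      \<open>W \<xi>\<close>.\<close>
    then obtain Y where Y: "Y \<subseteq> ?Z" "|Field \<kappa>| =o |Y|"
      unfolding internalize_card_of_ordLeq2[of "Field \<kappa>" ?Z] by (elim exE conjE)
    have Y_iso: "|Y| =o \<kappa>"
      using Y(2) assms(1) by (meson card_of_Field_ordIso ordIso_symmetric ordIso_transitive)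
    have YF: "Y \<subseteq> F" using Y(1) by (auto simp: Inter_within_def)
    have "|Y| \<le>o \<kappa>" using Y_iso ordIso_imp_ordLeq by blast
    from Cinfinite_ordLeq_nonempty[OF \<mu> S[OF YF this]]
    obtain \<beta> where \<beta>: "\<beta> \<in> F" "S \<beta> = Y" by blast
    have "|insert \<beta> Y| \<le>o \<kappa>"
      using Un_Cinfinite_bound[OF fin[of "{\<beta>}"] \<open>|Y| \<le>o \<kappa>\<close> inf] by simp
    then obtain \<gamma> where \<gamma>: "\<gamma> \<in> F" "\<And>\<alpha>. \<alpha> \<in> insert \<beta> Y \<Longrightarrow> (\<alpha>, \<gamma>) \<in> \<mu>"
      using bound[of "insert \<beta> Y"] YF \<beta> by blast
    \<comment> \<open>Including \<open>\<gamma>\<close> forces the next \<open>\<xi>\<close>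
      strictly above it, so \<open>\<beta>\<close> and \<open>Y\<close> lie strictly below
      \<open>\<xi>\<close> even if \<open>\<gamma>\<close> is among them.\<close>
    have "|insert \<gamma> (underS \<mu> \<gamma>)| <o \<mu>"
      using Un_Cinfinite_bound[OF fin[of "{\<gamma>}"] _ inf] small[OF \<gamma>(1)] less_iff by fastforce
    then have "\<not> X \<subseteq> insert \<gamma> (underS \<mu> \<gamma>)"
      using \<open>\<mu> \<le>o |X|\<close> by (meson card_of_mono1 not_ordLess_ordLeq ordLeq_transitive)
    then obtain \<xi> where \<xi>: "\<xi> \<in> X" "\<xi> \<noteq> \<gamma>" "\<xi> \<notin> underS \<mu> \<gamma>" by blast
    then have "(\<gamma>, \<xi>) \<in> \<mu>" using tail X \<gamma> by blast
    then have below: "\<alpha> \<in> underS \<mu> \<xi>" if "\<alpha> \<in> insert \<beta> Y" for \<alpha>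
      using \<gamma>(2)[OF that] \<xi>(2) tr as by (auto simp: underS_def dest: transD antisymD)
    have "Y \<inter> W \<xi> \<noteq> {} \<and> Y - W \<xi> \<noteq> {}"
      using W[of \<xi> \<beta>] below \<xi>(1) X(1) \<beta>(2) Y_iso
      by (auto dest: ordIso_symmetric[THEN ordIso_imp_ordLeq])
    \<comment> \<open>The right side does not depend on \<open>\<alpha>\<close>: \<open>Y\<close>
      lies inside \<open>W \<xi>\<close> or misses it, so it is not split.\<close>
    moreover have "\<alpha> \<in> W \<xi> \<longleftrightarrow> \<not> h (A \<xi>)" if "\<alpha> \<in> Y" for \<alpha>
    proof -
      have "\<alpha> \<in> A \<xi> \<longleftrightarrow> \<not> h (A \<xi>)"
        using Y(1) that \<xi>(1) unfolding X(2) Inter_eq by blast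
      moreover have "\<alpha> \<in> A \<xi> \<longleftrightarrow> \<alpha> \<in> W \<xi>"
        using below that YF by (auto simp: A_def)
      ultimately show ?thesis by simp
    qed
    ultimately show False by blast
  qed
  have "barely_independent \<mu> \<mu> (A ` F)"
    unfolding barely_independent_def
    using \<mu> ordLeq_refl[of \<mu>] size A_card low high by (auto simp flip: F_def)
  then show ?thesis
    unfolding \<mu>_def by blast
qed

end
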